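(* Let $G$ be a finitely generated group hyperbolic relative to a finite collection $\mathcal P=\{P_\lambda\}_{\lambda\in\Lambda}$, and $S$ a finite generating set. Then for all sufficiently large $n$, every finite subgroup $F\le G$ fixes a clique of the $n$-Rips graph $\Gamma_n$, i.e. there is a nonempty clique of $\Gamma_n$ that is mapped to itself by every element of $F$.
   Context: Let $\Gamma$ be the Cayley graph of $G$ with respect to $S$, $V=G$, $W$ the set of cosets $gP_\lambda$. Relative hyperbolicity means the coned-off Cayley graph (vertex set $V\cup W$, edges of $\Gamma$ plus an edge $(v,w)$ whenever $v\in w$) is fine and $\delta$-hyperbolic. Extend $|\cdot,\cdot|_S$ to $V\cup W$ via distances in $\Gamma$ between the corresponding elements/cosets. $\Gamma_n$ has vertex set $V\cup W$, an edge between $u\ne u'$ whenever $|u,u'|_S\le n$, and $G$ acts by left multiplication. *)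

theory Defs
  imports "HOL-Algebra.Generated_Groups" "HOL-Algebra.Coset" Complex_Main
begin

definition walk :: "('v \<Rightarrow> 'v \<Rightarrow> bool) \<Rightarrow> 'v list \<Rightarrow> bool" where
  "walk adj xs \<longleftrightarrow> xs \<noteq> [] \<and> (\<forall>i. Suc i < length xs \<longrightarrow> adj (xs ! i) (xs ! Suc i))"

definition setdist :: "('v \<Rightarrow> 'v \<Rightarrow> bool) \<Rightarrow> 'v set \<Rightarrow> 'v set \<Rightarrow> nat" where
  "setdist adj A B = (LEAST n. \<exists>xs. walk adj xs \<and> hd xs \<in> A \<and> last xs \<in> B \<and> length xs = Suc n)"

definition gdist :: "('v \<Rightarrow> 'v \<Rightarrow> bool) \<Rightarrow> 'v \<Rightarrow> 'v \<Rightarrow> nat" where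
  "gdist adj x y = setdist adj {x} {y}"

definition connected_graph :: "'v set \<Rightarrow> ('v \<Rightarrow> 'v \<Rightarrow> bool) \<Rightarrow> bool" where
  "connected_graph V adj \<longleftrightarrow> (\<forall>x\<in>V. \<forall>y\<in>V. \<exists>xs. walk adj xs \<and> hd xs = x \<and> last xs = y)"

definition gromov_product :: "('v \<Rightarrow> 'v \<Rightarrow> bool) \<Rightarrow> 'v \<Rightarrow> 'v \<Rightarrow> 'v \<Rightarrow> real" where
  "gromov_product adj x y w =
     (real (gdist adj w x) + real (gdist adj w y) - real (gdist adj x y)) / 2"

definition hyperbolic_graph :: "'v set \<Rightarrow> ('v \<Rightarrow> 'v \<Rightarrow> bool) \<Rightarrow> real \<Rightarrow> bool" where
  "hyperbolic_graph V adj \<delta> \<longleftrightarrow> connected_graph V adj \<and>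
     (\<forall>x\<in>V. \<forall>y\<in>V. \<forall>z\<in>V. \<forall>w\<in>V.
        gromov_product adj x z w \<ge> min (gromov_product adj x y w) (gromov_product adj y z w) - \<delta>)"

definition circuit :: "('v \<Rightarrow> 'v \<Rightarrow> bool) \<Rightarrow> 'v list \<Rightarrow> bool" where
  "circuit adj c \<longleftrightarrow> length c \<ge> 3 \<and> distinct c \<and>
     (\<forall>i<length c. adj (c ! i) (c ! (Suc i mod length c)))"

definition circuit_contains_edge :: "'v list \<Rightarrow> 'v \<Rightarrow> 'v \<Rightarrow> bool" where
  "circuit_contains_edge c u v \<longleftrightarrow>
     (\<exists>i<length c. {c ! i, c ! (Suc i mod length c)} = {u, v})"

definition fine_graph :: "('v \<Rightarrow> 'v \<Rightarrow> bool) \<Rightarrow> bool" where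
  "fine_graph adj \<longleftrightarrow> (\<forall>u v. adj u v \<longrightarrow>
     (\<forall>n. finite {c. circuit adj c \<and> length c = n \<and> circuit_contains_edge c u v}))"

definition clique :: "'v set \<Rightarrow> ('v \<Rightarrow> 'v \<Rightarrow> bool) \<Rightarrow> 'v set \<Rightarrow> bool" where
  "clique V adj C \<longleftrightarrow> C \<subseteq> V \<and> (\<forall>x\<in>C. \<forall>y\<in>C. x \<noteq> y \<longrightarrow> adj x y)"

definition cayley_adj :: "('a, 'b) monoid_scheme \<Rightarrow> 'a set \<Rightarrow> 'a \<Rightarrow> 'a \<Rightarrow> bool" where
  "cayley_adj G S x y \<longleftrightarrow> x \<in> carrier G \<and> y \<in> carrier G \<and> x \<noteq> y \<and>
     (\<exists>s\<in>S. y = x \<otimes>\<^bsub>G\<^esub> s \<or> x = y \<otimes>\<^bsub>G\<^esub> s)"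

definition cosets_W :: "('a, 'b) monoid_scheme \<Rightarrow> ('l \<Rightarrow> 'a set) \<Rightarrow> 'l set \<Rightarrow> 'a set set" where
  "cosets_W G P \<Lambda> = {g <#\<^bsub>G\<^esub> P l | g l. g \<in> carrier G \<and> l \<in> \<Lambda>}"

definition VW :: "('a, 'b) monoid_scheme \<Rightarrow> ('l \<Rightarrow> 'a set) \<Rightarrow> 'l set \<Rightarrow> ('a + 'a set) set" where
  "VW G P \<Lambda> = Inl ` carrier G \<union> Inr ` cosets_W G P \<Lambda>"

definition coned_adj ::
  "('a, 'b) monoid_scheme \<Rightarrow> 'a set \<Rightarrow> ('l \<Rightarrow> 'a set) \<Rightarrow> 'l set \<Rightarrow> ('a + 'a set) \<Rightarrow> ('a + 'a set) \<Rightarrow> bool" where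
  "coned_adj G S P \<Lambda> u v \<longleftrightarrow> u \<in> VW G P \<Lambda> \<and> v \<in> VW G P \<Lambda> \<and>
     (case (u, v) of
        (Inl x, Inl y) \<Rightarrow> cayley_adj G S x y
      | (Inl x, Inr w) \<Rightarrow> x \<in> w
      | (Inr w, Inl x) \<Rightarrow> x \<in> w
      | (Inr _, Inr _) \<Rightarrow> False)"

definition relatively_hyperbolic ::
  "('a, 'b) monoid_scheme \<Rightarrow> 'a set \<Rightarrow> ('l \<Rightarrow> 'a set) \<Rightarrow> 'l set \<Rightarrow> bool" where
  "relatively_hyperbolic G S P \<Lambda> \<longleftrightarrow>
     fine_graph (coned_adj G S P \<Lambda>) \<and>
     (\<exists>\<delta>. hyperbolic_graph (VW G P \<Lambda>) (coned_adj G S P \<Lambda>) \<delta>)"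

fun as_set :: "('a + 'a set) \<Rightarrow> 'a set" where
  "as_set (Inl g) = {g}"
| "as_set (Inr w) = w"

definition distS :: "('a, 'b) monoid_scheme \<Rightarrow> 'a set \<Rightarrow> ('a + 'a set) \<Rightarrow> ('a + 'a set) \<Rightarrow> nat" where
  "distS G S u u' = setdist (cayley_adj G S) (as_set u) (as_set u')"

definition rips_adj ::
  "('a, 'b) monoid_scheme \<Rightarrow> 'a set \<Rightarrow> ('l \<Rightarrow> 'a set) \<Rightarrow> 'l set \<Rightarrow> nat \<Rightarrow> ('a + 'a set) \<Rightarrow> ('a + 'a set) \<Rightarrow> bool" where
  "rips_adj G S P \<Lambda> n u u' \<longleftrightarrow> u \<in> VW G P \<Lambda> \<and> u' \<in> VW G P \<Lambda> \<and> u \<noteq> u' \<and> distS G S u u' \<le> n"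

fun left_act :: "('a, 'b) monoid_scheme \<Rightarrow> 'a \<Rightarrow> ('a + 'a set) \<Rightarrow> ('a + 'a set)" where
  "left_act G g (Inl x) = Inl (g \<otimes>\<^bsub>G\<^esub> x)"
| "left_act G g (Inr w) = Inr (g <#\<^bsub>G\<^esub> w)"

end

theory Submission
  imports Defs
begin

text \<open>Minimal-eccentricity vertices of an \<open>F\<close>-orbit in the coned-off graph \<open>K\<close> form an
  \<open>F\<close>-invariant set \<open>X\<close> whose diameter is bounded in terms of \<open>\<delta>\<close>, by the four-point condition.
  Such a set may still be unbounded for the word metric, because geodesics of \<open>K\<close> can turn by a
  large angle at a coset. If some vertex \<open>w\<close> coarsely separates two points of \<open>X\<close> that are
  farthest from \<open>w\<close>, then from any other vertex \<open>w'\<close> of bounded eccentricity one of these two points is reached only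
  through \<open>w\<close>, so \<open>w\<close> has strictly smaller eccentricity than \<open>w'\<close>; hence \<open>w\<close> is unique and
  fixed by \<open>F\<close>. Otherwise no vertex coarsely separates two minimal-eccentricity vertices of \<open>X\<close>,
  as a geodesic from such a vertex to a point farthest from \<open>w\<close> misses \<open>w\<close>. By fineness a
  geodesic of \<open>K\<close> between two of them then turns only by bounded angles at cosets, which bounds
  their distance in the word metric.\<close>

section \<open>Walks and distances in connected graphs\<close>

text \<open>Replacing vertex lists by powers of the adjacency relation gives concatenation, reversal
  and subwalks through \<open>^^\<close>. A walk with n edges has \<open>Suc n\<close>
  vertices.\<close>

lemma walk_iff_relpowp:
  "(\<exists>xs. walk adj xs \<and> hd xs = x \<and> last xs = y \<and> length xs = Suc n) \<longleftrightarrow> (adj ^^ n) x y"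
proof
  assume "\<exists>xs. walk adj xs \<and> hd xs = x \<and> last xs = y \<and> length xs = Suc n"
  then obtain xs where xs: "walk adj xs" "hd xs = x" "last xs = y" "length xs = Suc n" by blast
  then have "xs \<noteq> []" by auto
  then have "xs ! 0 = x" "xs ! n = y"
    using xs by (auto simp: hd_conv_nth last_conv_nth)
  moreover have "\<forall>i<n. adj (xs ! i) (xs ! Suc i)" using xs by (auto simp: walk_def)
  ultimately show "(adj ^^ n) x y" unfolding relpowp_fun_conv by (intro exI[of _ "\<lambda>i. xs ! i"]) auto
next
  assume "(adj ^^ n) x y"
  then obtain f where f: "f 0 = x" "f n = y" "\<forall>i<n. adj (f i) (f (Suc i))"
    unfolding relpowp_fun_conv by blast
  let ?xs = "map f [0..<Suc n]"
  have "walk adj ?xs" using f(3) unfolding walk_def by (auto simp del: upt_Suc)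
  moreover have "hd ?xs = x" using f(1) by (simp add: hd_map del: upt_Suc)
  moreover have "last ?xs = y" using f(2) by simp
  ultimately show "\<exists>xs. walk adj xs \<and> hd xs = x \<and> last xs = y \<and> length xs = Suc n"
    by (intro exI[of _ ?xs]) simp
qed

lemma setdist_le:
  assumes "(adj ^^ n) x y" "x \<in> A" "y \<in> B"
  shows "setdist adj A B \<le> n"
proof -
  obtain xs where "walk adj xs" "hd xs = x" "last xs = y" "length xs = Suc n"
    using assms(1) unfolding walk_iff_relpowp[symmetric] by blast
  then show ?thesis unfolding setdist_def using assms by (intro Least_le) auto
qed

lemma gdist_eq: "gdist adj x y = (LEAST n. (adj ^^ n) x y)"
proof -
  have "(\<exists>xs. walk adj xs \<and> hd xs \<in> {x} \<and> last xs \<in> {y} \<and> length xs = Suc n) \<longleftrightarrow> (adj ^^ n) x y" for n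
    using walk_iff_relpowp[of adj x y n] by simp
  then show ?thesis unfolding gdist_def setdist_def by simp
qed

lemma relpowp_trans: "(R ^^ m) x y \<Longrightarrow> (R ^^ n) y z \<Longrightarrow> (R ^^ (m + n)) x z"
  by (auto simp: relpowp_add)

lemma relpowp_sym:
  assumes "\<And>a b. R a b \<Longrightarrow> R b a"
  shows "(R ^^ n) x y \<Longrightarrow> (R ^^ n) y x"
proof (induction n arbitrary: y)
  case (Suc n)
  then obtain z where "(R ^^ n) x z" "R z y" by auto
  then show ?case using Suc.IH assms by (meson relpowp_Suc_I2)
qed auto

lemma relpowp_segment:
  assumes "\<And>k. i \<le> k \<Longrightarrow> k < j \<Longrightarrow> R (p k) (p (Suc k))" "i \<le> j"
  shows "(R ^^ (j - i)) (p i) (p j)"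
  unfolding relpowp_fun_conv using assms
  by (intro exI[of _ "\<lambda>k. p (i + k)"]) auto

text \<open>A walk of minimal length visits no vertex twice, since the part between two visits could
  be cut out.\<close>

lemma relpowp_shortest_distinct:
  assumes "(R ^^ n) x y"
  obtains xs where "distinct xs" "xs \<noteq> []" "hd xs = x" "last xs = y" "length xs \<le> Suc n"
    "\<And>i. Suc i < length xs \<Longrightarrow> R (xs ! i) (xs ! Suc i)"
proof -
  define m where "m = (LEAST n. (R ^^ n) x y)"
  have m: "(R ^^ m) x y" unfolding m_def using assms by (rule LeastI)
  have mn: "m \<le> n" unfolding m_def using assms by (rule Least_le)
  obtain f where f: "f 0 = x" "f m = y" "\<forall>i<m. R (f i) (f (Suc i))"
    using m unfolding relpowp_fun_conv by blast
  have ne: "f i \<noteq> f j" if "i < j" "j \<le> m" for i j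
  proof
    assume eq: "f i = f j"
    have "(R ^^ (i - 0)) (f 0) (f i)" by (rule relpowp_segment) (use f that in auto)
    moreover have "(R ^^ (m - j)) (f j) (f m)" by (rule relpowp_segment) (use f that in auto)
    ultimately have "(R ^^ (i + (m - j))) x y" using relpowp_trans f eq by fastforce
    then have "m \<le> i + (m - j)" unfolding m_def by (rule Least_le)
    then show False using that by linarith
  qed
  show thesis
  proof
    show "distinct (map f [0..<Suc m])"
      unfolding distinct_map
      by (auto simp: inj_on_def simp del: upt_Suc) (metis less_Suc_eq_le linorder_neqE_nat ne)
    show "hd (map f [0..<Suc m]) = x" using f by (simp add: hd_map del: upt_Suc)
    show "last (map f [0..<Suc m]) = y" using f by simp
    show "length (map f [0..<Suc m]) \<le> Suc n" using mn by simp
  qed (use f in \<open>auto simp del: upt_Suc\<close>)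
qed

section \<open>Walks that avoid a vertex, and graph automorphisms\<close>

text \<open>Excluding \<open>w\<close> edge by edge yields a relation whose powers are the walks
  missing \<open>w\<close>. The one exception is the walk of length 0 at \<open>w\<close>
  itself.\<close>

definition avoiding :: "('v \<Rightarrow> 'v \<Rightarrow> bool) \<Rightarrow> 'v \<Rightarrow> 'v \<Rightarrow> 'v \<Rightarrow> bool" where
  "avoiding adj w a b \<longleftrightarrow> adj a b \<and> a \<noteq> w \<and> b \<noteq> w"

definition automorphism :: "'v set \<Rightarrow> ('v \<Rightarrow> 'v \<Rightarrow> bool) \<Rightarrow> ('v \<Rightarrow> 'v) \<Rightarrow> bool" where
  "automorphism V adj \<phi> \<longleftrightarrow> bij_betw \<phi> V V \<and> (\<forall>x\<in>V. \<forall>y\<in>V. adj (\<phi> x) (\<phi> y) \<longleftrightarrow> adj x y)"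

text \<open>There are two relations because an automorphism \<open>\<phi>\<close> turns walks
  avoiding \<open>w\<close> into walks avoiding \<open>\<phi> w\<close>. Intermediate vertices lie
  in \<open>V\<close>, so they have preimages.\<close>

lemma relpowp_image_iff:
  assumes "bij_betw \<phi> V V"
    and "\<And>x y. x \<in> V \<Longrightarrow> y \<in> V \<Longrightarrow> R (\<phi> x) (\<phi> y) \<longleftrightarrow> R' x y"
    and "\<And>x y. R x y \<Longrightarrow> x \<in> V \<and> y \<in> V" "\<And>x y. R' x y \<Longrightarrow> x \<in> V \<and> y \<in> V"
    and "x \<in> V" "y \<in> V"
  shows "(R ^^ n) (\<phi> x) (\<phi> y) \<longleftrightarrow> (R' ^^ n) x y"
  using assms(6)
proof (induction n arbitrary: y)
  case 0
  then show ?case using assms(1,5) by (auto simp: bij_betw_def inj_on_def)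
next
  case (Suc n)
  have sur: "\<exists>u\<in>V. z = \<phi> u" if "z \<in> V" for z using assms(1) that by (auto simp: bij_betw_def)
  show ?case
  proof
    assume "(R ^^ Suc n) (\<phi> x) (\<phi> y)"
    then obtain z where z: "(R ^^ n) (\<phi> x) z" "R z (\<phi> y)" by auto
    then obtain u where u: "u \<in> V" "z = \<phi> u" using assms(3) sur by meson
    then have "(R' ^^ n) x u" "R' u y" using z Suc assms(2) by auto
    then show "(R' ^^ Suc n) x y" by auto
  next
    assume "(R' ^^ Suc n) x y"
    then obtain u where u: "(R' ^^ n) x u" "R' u y" by auto
    then have "u \<in> V" using assms(4) by blast
    then have "(R ^^ n) (\<phi> x) (\<phi> u)" "R (\<phi> u) (\<phi> y)" using u Suc assms(2) by auto
    then show "(R ^^ Suc n) (\<phi> x) (\<phi> y)" by auto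
  qed
qed

locale connected_simple_graph =
  fixes V :: "'v set" and adj :: "'v \<Rightarrow> 'v \<Rightarrow> bool"
  assumes adj_in: "adj x y \<Longrightarrow> x \<in> V \<and> y \<in> V"
    and adj_sym: "adj x y \<Longrightarrow> adj y x"
    and conn: "connected_graph V adj"
begin

abbreviation d :: "'v \<Rightarrow> 'v \<Rightarrow> nat" where "d \<equiv> gdist adj"

lemma dist_walk: assumes "x \<in> V" "y \<in> V" shows "(adj ^^ d x y) x y"
proof -
  obtain xs where xs: "walk adj xs" "hd xs = x" "last xs = y"
    using conn assms unfolding connected_graph_def by blast
  then have "length xs = Suc (length xs - 1)" by (simp add: walk_def)
  then have "(adj ^^ (length xs - 1)) x y" using xs walk_iff_relpowp by metis
  then show ?thesis unfolding gdist_eq by (rule LeastI)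
qed

lemma dist_le: "(adj ^^ n) x y \<Longrightarrow> d x y \<le> n"
  unfolding gdist_eq by (rule Least_le)

lemma dist_commute: "x \<in> V \<Longrightarrow> y \<in> V \<Longrightarrow> d x y = d y x"
  by (meson dist_le dist_walk relpowp_sym adj_sym antisym)

lemma dist_triangle: "x \<in> V \<Longrightarrow> y \<in> V \<Longrightarrow> z \<in> V \<Longrightarrow> d x z \<le> d x y + d y z"
  by (meson dist_le dist_walk relpowp_trans)

lemma dist_self: "d x x = 0"
  using dist_le[of 0 x x] by simp

lemma dist_eq_0: "x \<in> V \<Longrightarrow> y \<in> V \<Longrightarrow> d x y = 0 \<Longrightarrow> x = y"
  using dist_walk[of x y] by simp

lemma geodesic:
  assumes "x \<in> V" "y \<in> V"
  obtains p where "p 0 = x" "p (d x y) = y" "\<And>i. i < d x y \<Longrightarrow> adj (p i) (p (Suc i))"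
    "\<And>i. i \<le> d x y \<Longrightarrow> p i \<in> V \<and> d x (p i) = i \<and> d (p i) y = d x y - i"
proof -
  obtain p where p: "p 0 = x" "p (d x y) = y" "\<forall>i<d x y. adj (p i) (p (Suc i))"
    using dist_walk[OF assms] unfolding relpowp_fun_conv by blast
  have "p i \<in> V \<and> d x (p i) = i \<and> d (p i) y = d x y - i" if "i \<le> d x y" for i
  proof -
    have V: "p i \<in> V"
      by (metis p adj_in assms(2) le_neq_implies_less that)
    have "(adj ^^ (i - 0)) (p 0) (p i)" "(adj ^^ (d x y - i)) (p i) (p (d x y))"
      by (rule relpowp_segment; use p that in simp)+
    then have "d x (p i) \<le> i" "d (p i) y \<le> d x y - i" using p dist_le by fastforce+
    moreover have "d x y \<le> d x (p i) + d (p i) y" using dist_triangle V assms by blast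
    ultimately show ?thesis using V that by linarith
  qed
  with p that show thesis by blast
qed

text \<open>Fix one geodesic from \<open>x\<close> to \<open>y\<close>: either it misses
  \<open>w\<close>, or \<open>w\<close> cuts it into two geodesics.\<close>

lemma avoiding_or_dist_split:
  assumes "x \<in> V" "y \<in> V"
  shows "(avoiding adj w ^^ d x y) x y \<or> d x y = d x w + d w y"
proof -
  obtain p where p: "p 0 = x" "p (d x y) = y" "\<And>i. i < d x y \<Longrightarrow> adj (p i) (p (Suc i))"
    "\<And>i. i \<le> d x y \<Longrightarrow> p i \<in> V \<and> d x (p i) = i \<and> d (p i) y = d x y - i"
    using geodesic[OF assms] by blast
  show ?thesis
  proof (cases "\<exists>i\<le>d x y. p i = w")
    case True
    then show ?thesis using p(4) by force
  next
    case False
    then have "(avoiding adj w ^^ (d x y - 0)) (p 0) (p (d x y))"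
      using p(3) by (intro relpowp_segment) (auto simp: avoiding_def)
    then show ?thesis using p by simp
  qed
qed

lemma avoiding_sym: "(avoiding adj w ^^ n) x y \<Longrightarrow> (avoiding adj w ^^ n) y x"
  by (rule relpowp_sym) (auto simp: avoiding_def adj_sym)

lemma automorphism_avoiding_iff:
  assumes "automorphism V adj \<phi>" "x \<in> V" "y \<in> V" "w \<in> V"
  shows "(avoiding adj (\<phi> w) ^^ n) (\<phi> x) (\<phi> y) \<longleftrightarrow> (avoiding adj w ^^ n) x y"
proof (rule relpowp_image_iff)
  show "bij_betw \<phi> V V" using assms by (auto simp: automorphism_def)
  fix a b assume "a \<in> V" "b \<in> V"
  then show "avoiding adj (\<phi> w) (\<phi> a) (\<phi> b) \<longleftrightarrow> avoiding adj w a b"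
    using assms unfolding avoiding_def automorphism_def bij_betw_def inj_on_def by blast
qed (use assms adj_in in \<open>auto simp: avoiding_def\<close>)

lemma automorphism_dist:
  assumes "automorphism V adj \<phi>" "x \<in> V" "y \<in> V"
  shows "d (\<phi> x) (\<phi> y) = d x y"
proof -
  have "(adj ^^ n) (\<phi> x) (\<phi> y) \<longleftrightarrow> (adj ^^ n) x y" for n
    using assms adj_in by (intro relpowp_image_iff[of _ V]) (auto simp: automorphism_def)
  then show ?thesis unfolding gdist_eq by simp
qed

section \<open>Coarse centres of bounded sets\<close>

text \<open>For a \<open>bounded_set\<close> and \<open>u\<close> in \<open>V\<close> the set of
  distances is finite and nonempty, so \<open>Max\<close> is a true maximum even if \<open>X\<close>
  is infinite.\<close>

definition ecc :: "'v set \<Rightarrow> 'v \<Rightarrow> nat" where "ecc X u = Max (d u ` X)"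

definition centres :: "'v set \<Rightarrow> 'v set" where
  "centres X = {u \<in> V. \<forall>v\<in>V. ecc X u \<le> ecc X v}"

lemma centres_nonempty: "V \<noteq> {} \<Longrightarrow> centres X \<noteq> {}"
  using ex_has_least_nat[of "\<lambda>u. u \<in> V" _ "ecc X"] unfolding centres_def by fastforce

text \<open>Boundedness stands in for finiteness: centres are taken twice, and without local
  finiteness the first set of centres may be infinite.\<close>

definition bounded_set :: "'v set \<Rightarrow> nat \<Rightarrow> bool" where
  "bounded_set X R \<longleftrightarrow> X \<subseteq> V \<and> X \<noteq> {} \<and> (\<forall>x\<in>X. \<forall>y\<in>X. d x y \<le> R)"

lemma finite_dist_image:
  assumes "bounded_set X R" "u \<in> V" shows "finite (d u ` X)"
proof -
  obtain x where x: "x \<in> X" using assms by (auto simp: bounded_set_def)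
  have "d u y \<le> d u x + R" if "y \<in> X" for y
  proof -
    have "d u y \<le> d u x + d x y" using dist_triangle assms x that by (auto simp: bounded_set_def)
    also have "d x y \<le> R" using assms x that by (auto simp: bounded_set_def)
    finally show ?thesis by simp
  qed
  then have "d u ` X \<subseteq> {..d u x + R}" by auto
  then show ?thesis using finite_subset by blast
qed

lemma dist_le_ecc: "bounded_set X R \<Longrightarrow> u \<in> V \<Longrightarrow> x \<in> X \<Longrightarrow> d u x \<le> ecc X u"
  unfolding ecc_def using finite_dist_image by (intro Max_ge) auto

lemma ecc_attained:
  assumes "bounded_set X R" "u \<in> V"
  obtains x where "x \<in> X" "d u x = ecc X u"
proof -
  have "ecc X u \<in> d u ` X" unfolding ecc_def
    using finite_dist_image[OF assms] assms by (intro Max_in) (auto simp: bounded_set_def)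
  then show thesis using that by auto
qed

lemma automorphism_ecc:
  assumes "automorphism V adj \<phi>" "\<phi> ` X = X" "X \<subseteq> V" "u \<in> V"
  shows "ecc X (\<phi> u) = ecc X u"
proof -
  have "d (\<phi> u) ` X = d (\<phi> u) ` \<phi> ` X" using assms by simp
  also have "\<dots> = d u ` X" unfolding image_image
    using automorphism_dist[OF assms(1)] assms by (intro image_cong) auto
  finally show ?thesis by (simp add: ecc_def)
qed

lemma automorphism_centres:
  assumes "automorphism V adj \<phi>" "\<phi> ` X = X" "X \<subseteq> V"
  shows "\<phi> ` centres X = centres X"
proof -
  have V: "\<phi> ` V = V" using assms by (auto simp: automorphism_def bij_betw_def)
  have iff: "\<phi> u \<in> centres X \<longleftrightarrow> u \<in> centres X" if "u \<in> V" for u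
    using that V automorphism_ecc[OF assms] unfolding centres_def by auto
  show ?thesis
  proof
    show "\<phi> ` centres X \<subseteq> centres X" using iff by (auto simp: centres_def)
    show "centres X \<subseteq> \<phi> ` centres X"
    proof
      fix z assume z: "z \<in> centres X"
      then obtain u where "u \<in> V" "z = \<phi> u" using V by (auto simp: centres_def)
      then show "z \<in> \<phi> ` centres X" using iff z by blast
    qed
  qed
qed

text \<open>Let \<open>m\<close> be the midpoint of a geodesic between the two centres and
  \<open>x\<close> a point of \<open>X\<close> farthest from \<open>m\<close>. Minimality of the
  centres' eccentricity makes \<open>x\<close> at least as far from \<open>m\<close> as from either
  centre. The four-point condition based at \<open>x\<close> then bounds one half of the geodesic by
  2 \<open>\<delta>\<close>.\<close>

lemma hyperbolic_centres_diameter: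
  assumes hyp: "hyperbolic_graph V adj \<delta>" and X: "bounded_set X R"
    and u: "u \<in> centres X" "u' \<in> centres X"
  shows "real (d u u') \<le> 4 * \<delta> + 1"
proof -
  have uV: "u \<in> V" "u' \<in> V" using u by (auto simp: centres_def)
  obtain p where p: "\<And>i. i \<le> d u u' \<Longrightarrow> p i \<in> V \<and> d u (p i) = i \<and> d (p i) u' = d u u' - i"
    using geodesic[OF uV] by blast
  define k where "k = d u u' div 2"
  define m where "m = p k"
  have m: "m \<in> V" "d u m = k" "d m u' = d u u' - k" using p[of k] by (auto simp: k_def m_def)
  obtain x where x: "x \<in> X" "d m x = ecc X m" using ecc_attained X m by blast
  have xV: "x \<in> V" using x X by (auto simp: bounded_set_def)
  have e: "ecc X u \<le> ecc X m" "ecc X u' \<le> ecc X m" "ecc X u = ecc X u'"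
    using u m uV by (auto simp: centres_def intro: antisym)
  have dx: "d x u \<le> ecc X m" "d x u' \<le> ecc X m" "d x m = ecc X m"
    using dist_le_ecc[OF X uV(1) x(1)] dist_le_ecc[OF X uV(2) x(1)] e x(2)
      dist_commute[OF xV uV(1)] dist_commute[OF xV uV(2)] dist_commute[OF xV m(1)] by linarith+
  have "gromov_product adj u u' x \<ge> min (gromov_product adj u m x) (gromov_product adj m u' x) - \<delta>"
    using hyp uV m xV unfolding hyperbolic_graph_def by blast
  \<comment> \<open>The halves differ by one when the distance is odd; this rounding is the source
    of the summand 1.\<close>
  moreover have "real k \<le> real (d u u') / 2" "real (d u u' - k) \<le> real (d u u') / 2 + 1/2"
    unfolding k_def by linarith+
  ultimately show ?thesis
    using dx m(2,3) unfolding gromov_product_def min_def by (auto split: if_splits simp: field_simps)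
qed

section \<open>Vertices that separate farthest points\<close>

text \<open>If \<open>X\<close> has diameter at most R, a vertex within 2R of a centre has
  eccentricity at most 3R. The bound 6R is the length of two geodesics from a vertex of such
  eccentricity, joined end to end. The case n = 0 forces \<open>x\<close> and \<open>y\<close> to
  differ.\<close>

definition branch_centre :: "'v set \<Rightarrow> nat \<Rightarrow> 'v \<Rightarrow> bool" where
  "branch_centre X R w \<longleftrightarrow> w \<in> V \<and> ecc X w \<le> 3 * R \<and>
     (\<exists>x\<in>X. \<exists>y\<in>X. d w x = ecc X w \<and> d w y = ecc X w \<and> (\<forall>n\<le>6 * R. \<not> (avoiding adj w ^^ n) x y))"

text \<open>Geodesics from \<open>w'\<close> to the two separated points cannot both miss
  \<open>w\<close>, as together they would be a detour of length at most 6R. One of the two points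
  is thus reached through \<open>w\<close>, at distance \<open>d w' w + ecc X w\<close>.\<close>

lemma branch_centre_ecc:
  assumes X: "bounded_set X R" and w: "branch_centre X R w"
    and w': "w' \<in> V" "ecc X w' \<le> 3 * R"
  shows "d w' w + ecc X w \<le> ecc X w'"
proof -
  obtain x y where xy: "x \<in> X" "y \<in> X" "d w x = ecc X w" "d w y = ecc X w"
    "\<forall>n\<le>6 * R. \<not> (avoiding adj w ^^ n) x y"
    using w by (auto simp: branch_centre_def)
  have V: "x \<in> V" "y \<in> V" using xy X by (auto simp: bounded_set_def)
  have le: "d w' x \<le> ecc X w'" "d w' y \<le> ecc X w'" using dist_le_ecc X w' xy by blast+
  have "\<not> ((avoiding adj w ^^ d w' x) w' x \<and> (avoiding adj w ^^ d w' y) w' y)"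
  proof
    assume "(avoiding adj w ^^ d w' x) w' x \<and> (avoiding adj w ^^ d w' y) w' y"
    then have "(avoiding adj w ^^ (d w' x + d w' y)) x y"
      using relpowp_trans avoiding_sym by metis
    moreover have "d w' x + d w' y \<le> 6 * R" using le w' by linarith
    ultimately show False using xy by blast
  qed
  then have "d w' x = d w' w + d w x \<or> d w' y = d w' w + d w y"
    using avoiding_or_dist_split V w' by blast
  then show ?thesis using le xy by auto
qed

text \<open>Adding the inequality of \<open>branch_centre_ecc\<close> to the one with
  \<open>w\<close> and \<open>w'\<close> exchanged leaves no room for a positive distance.\<close>

lemma branch_centre_unique:
  assumes "bounded_set X R" "branch_centre X R w" "branch_centre X R w'"
  shows "w = w'"
proof -
  have "w \<in> V" "w' \<in> V" "d w' w + ecc X w \<le> ecc X w'" "d w w' + ecc X w' \<le> ecc X w"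
    using assms branch_centre_ecc by (auto simp: branch_centre_def)
  then show ?thesis using dist_eq_0[of w w'] by simp
qed

lemma automorphism_branch_centre:
  assumes "automorphism V adj \<phi>" "\<phi> ` X = X" "X \<subseteq> V" "branch_centre X R w"
  shows "branch_centre X R (\<phi> w)"
proof -
  obtain x y where xy: "w \<in> V" "ecc X w \<le> 3 * R" "x \<in> X" "y \<in> X" "d w x = ecc X w" "d w y = ecc X w"
    "\<forall>n\<le>6 * R. \<not> (avoiding adj w ^^ n) x y"
    using assms(4) by (auto simp: branch_centre_def)
  have V: "x \<in> V" "y \<in> V" using xy assms by auto
  have im: "\<phi> x \<in> X" "\<phi> y \<in> X" "\<phi> w \<in> V"
    using xy assms by (auto simp: automorphism_def bij_betw_def)
  show ?thesis unfolding branch_centre_def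
    using xy im V automorphism_ecc[OF assms(1-3)] automorphism_dist[OF assms(1)]
      automorphism_avoiding_iff[OF assms(1)]
    by (intro conjI bexI[of _ "\<phi> x"] bexI[of _ "\<phi> y"]) auto
qed

text \<open>From each of \<open>u\<close> and \<open>u'\<close> some point of \<open>X\<close>
  farthest from \<open>w\<close> is reached off \<open>w\<close> in at most R steps. Since
  \<open>w\<close> is not a branch centre, these two points are joined off \<open>w\<close> in at
  most 6R steps, which gives R + 6R + R in total.\<close>

lemma centres_not_separated:
  assumes X: "bounded_set X R" and no: "\<And>w. \<not> branch_centre X R w"
    and u: "u \<in> centres X" "u' \<in> centres X"
    and w: "w \<in> V" "w \<noteq> u" "w \<noteq> u'" "d u w \<le> 2 * R"
  shows "\<exists>n\<le>8 * R. (avoiding adj w ^^ n) u u'"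
proof -
  \<comment> \<open>A point of \<open>X\<close> already has eccentricity at most R, and a centre
    does no worse.\<close>
  have eR: "ecc X v \<le> R" if "v \<in> centres X" for v
  proof -
    obtain x where x: "x \<in> X" using X by (auto simp: bounded_set_def)
    then have xV: "x \<in> V" using X by (auto simp: bounded_set_def)
    obtain y where y: "y \<in> X" "d x y = ecc X x" using ecc_attained X xV by blast
    then have "ecc X x \<le> R" using X x by (force simp: bounded_set_def)
    moreover have "ecc X v \<le> ecc X x" using that xV by (auto simp: centres_def)
    ultimately show ?thesis by simp
  qed
  have far: "\<exists>x\<in>X. d w x = ecc X w \<and> (\<exists>n\<le>R. (avoiding adj w ^^ n) v x)"
    if v: "v \<in> centres X" "w \<noteq> v" for v
  proof -
    have vV: "v \<in> V" using v by (auto simp: centres_def)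
    obtain x where x: "x \<in> X" "d w x = ecc X w" using ecc_attained X w by blast
    have xV: "x \<in> V" using x X by (auto simp: bounded_set_def)
    have le: "d v x \<le> ecc X v" using dist_le_ecc X vV x by blast
    \<comment> \<open>Through \<open>w\<close> the point \<open>x\<close> would be at distance more
      than \<open>ecc X w\<close>, hence more than \<open>ecc X v\<close>, which is
      impossible.\<close>
    have "d v w > 0" using dist_eq_0 vV w v by blast
    moreover have "ecc X v \<le> ecc X w" using v w by (auto simp: centres_def)
    ultimately have "d v x \<noteq> d v w + d w x" using x le by linarith
    then have "(avoiding adj w ^^ d v x) v x" using avoiding_or_dist_split vV xV by blast
    then show ?thesis using x le eR[OF v(1)] by (meson order_trans)
  qed
  obtain x n where x: "x \<in> X" "d w x = ecc X w" "n \<le> R" "(avoiding adj w ^^ n) u x"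
    using far[OF u(1) w(2)] by blast
  obtain y m where y: "y \<in> X" "d w y = ecc X w" "m \<le> R" "(avoiding adj w ^^ m) u' y"
    using far[OF u(2) w(3)] by blast
  have V: "u \<in> V" "x \<in> V" using u x X by (auto simp: centres_def bounded_set_def)
  have "d w x \<le> d w u + d u x" using dist_triangle w V by blast
  also have "\<dots> \<le> 2 * R + R"
    using dist_commute[of u w] w V dist_le_ecc[OF X V(1) x(1)] eR[OF u(1)] by simp
  finally have "ecc X w \<le> 3 * R" using x by simp
  then obtain l where l: "l \<le> 6 * R" "(avoiding adj w ^^ l) x y"
    using no[of w] x y w unfolding branch_centre_def by blast
  have "(avoiding adj w ^^ ((n + l) + m)) u u'"
    using relpowp_trans[OF relpowp_trans[OF x(4) l(2)] avoiding_sym[OF y(4)]] .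
  then show ?thesis using x y l by (intro exI[of _ "n + l + m"]) auto
qed

text \<open>Passing to the centres of \<open>Y\<close> replaces a set of arbitrary diameter by one
  of diameter at most \<open>R\<close>, a bound that depends on \<open>\<delta>\<close> alone. The
  set \<open>C\<close> is then either the unique branch centre or the centres of the new
  set.\<close>

lemma hyperbolic_coarse_fixed_set:
  assumes hyp: "hyperbolic_graph V adj \<delta>" and R: "4 * \<delta> + 1 \<le> real R"
    and Y: "finite Y" "Y \<noteq> {}" "Y \<subseteq> V"
  obtains C where "C \<noteq> {}" "C \<subseteq> V"
    "\<And>u u'. u \<in> C \<Longrightarrow> u' \<in> C \<Longrightarrow> d u u' \<le> 2 * R"
    "\<And>u u' w. u \<in> C \<Longrightarrow> u' \<in> C \<Longrightarrow> w \<in> V \<Longrightarrow> w \<noteq> u \<Longrightarrow> w \<noteq> u' \<Longrightarrow> d u w \<le> 2 * R \<Longrightarrow>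
       \<exists>n\<le>8 * R. (avoiding adj w ^^ n) u u'"
    "\<And>\<phi>. automorphism V adj \<phi> \<Longrightarrow> \<phi> ` Y = Y \<Longrightarrow> \<phi> ` C = C"
proof -
  \<comment> \<open>This bound depends on \<open>Y\<close>, but the diameter of the centres does not
    depend on it.\<close>
  have bY: "bounded_set Y (Max (case_prod d ` (Y \<times> Y)))"
    unfolding bounded_set_def using Y by (auto intro!: Max_ge)
  define X where "X = centres Y"
  have XV: "X \<subseteq> V" by (auto simp: X_def centres_def)
  have ne: "V \<noteq> {}" using Y by auto
  have diam: "d u u' \<le> R" if "u \<in> centres Z" "u' \<in> centres Z" "bounded_set Z K" for u u' Z K
    using hyperbolic_centres_diameter[OF hyp that(3,1,2)] R by linarith
  have X: "bounded_set X R"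
    unfolding bounded_set_def using XV centres_nonempty[OF ne] diam bY by (auto simp: X_def)
  have inv: "\<phi> ` X = X" if "automorphism V adj \<phi>" "\<phi> ` Y = Y" for \<phi>
    using automorphism_centres that Y by (simp add: X_def)
  show thesis
  proof (cases "\<exists>w. branch_centre X R w")
    case True
    then obtain w where w: "branch_centre X R w" by blast
    \<comment> \<open>For a singleton the walk of length 0 serves as the required detour.\<close>
    show thesis
    proof (rule that[of "{w}"])
      show "{w} \<subseteq> V" using w by (auto simp: branch_centre_def)
      fix \<phi> assume "automorphism V adj \<phi>" "\<phi> ` Y = Y"
      then show "\<phi> ` {w} = {w}"
        using automorphism_branch_centre[OF _ inv XV w] branch_centre_unique[OF X] w by simp
    qed (auto simp: dist_self intro!: exI[of _ 0])
  next
    case False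
    show thesis
    proof (rule that[of "centres X"])
      show "centres X \<noteq> {}" using centres_nonempty ne by blast
      show "centres X \<subseteq> V" by (auto simp: centres_def)
      show "\<And>u u'. u \<in> centres X \<Longrightarrow> u' \<in> centres X \<Longrightarrow> d u u' \<le> 2 * R"
        using diam X by fastforce
      show "\<And>\<phi>. automorphism V adj \<phi> \<Longrightarrow> \<phi> ` Y = Y \<Longrightarrow> \<phi> ` centres X = centres X"
        by (rule automorphism_centres) (simp_all add: inv XV)
      show "\<exists>n\<le>8 * R. (avoiding adj w ^^ n) u u'"
        if "u \<in> centres X" "u' \<in> centres X" "w \<in> V" "w \<noteq> u" "w \<noteq> u'" "d u w \<le> 2 * R" for u u' w
        by (rule centres_not_separated[OF X _ that]) (use False in simp)
    qed
  qed
qed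

end

section \<open>The coned-off Cayley graph\<close>

locale peripheral_structure = group G for G :: "('a, 'b) monoid_scheme" (structure) +
  fixes S :: "'a set" and P :: "'l \<Rightarrow> 'a set" and \<Lambda> :: "'l set"
  assumes S_carrier: "S \<subseteq> carrier G" and generates: "generate G S = carrier G"
    and finite_index: "finite \<Lambda>" and subgroup_P: "l \<in> \<Lambda> \<Longrightarrow> subgroup (P l) G"
begin

abbreviation "cay \<equiv> cayley_adj G S"
abbreviation "K \<equiv> coned_adj G S P \<Lambda>"
abbreviation "KV \<equiv> VW G P \<Lambda>"

lemma P_carrier: "l \<in> \<Lambda> \<Longrightarrow> P l \<subseteq> carrier G"
  using subgroup_P subgroup.subset by blast

lemma coset_carrier: "w \<in> cosets_W G P \<Lambda> \<Longrightarrow> w \<subseteq> carrier G"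
  using P_carrier l_coset_subset_G by (auto simp: cosets_W_def) blast

text \<open>Every element of a coset represents it, so multiplication by \<open>inv a\<close> will
  move the coset to a subgroup \<open>P l\<close>.\<close>

lemma coset_representative:
  assumes "w \<in> cosets_W G P \<Lambda>" "a \<in> w"
  obtains l where "l \<in> \<Lambda>" "w = a <# P l"
proof -
  obtain g l where "g \<in> carrier G" "l \<in> \<Lambda>" "w = g <# P l"
    using assms by (auto simp: cosets_W_def)
  then show thesis using that l_repr_independence[of a g "P l"] subgroup_P assms by blast
qed

lemma left_act_in:
  assumes g: "g \<in> carrier G" and u: "u \<in> KV"
  shows "left_act G g u \<in> KV"
proof (cases u)
  case (Inl x)
  then show ?thesis using g u by (auto simp: VW_def)
next
  case (Inr w)
  then obtain h l where hl: "h \<in> carrier G" "l \<in> \<Lambda>" "w = h <# P l"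
    using u by (auto simp: VW_def cosets_W_def)
  then have "g <# w = (g \<otimes> h) <# P l" using g P_carrier by (simp add: lcos_m_assoc)
  then have "g <# w \<in> cosets_W G P \<Lambda>" using hl g unfolding cosets_W_def by blast
  then show ?thesis using Inr by (simp add: VW_def)
qed

lemma left_act_mult:
  "g \<in> carrier G \<Longrightarrow> h \<in> carrier G \<Longrightarrow> u \<in> KV \<Longrightarrow>
     left_act G g (left_act G h u) = left_act G (g \<otimes> h) u"
  using coset_carrier by (auto simp: VW_def lcos_m_assoc m_assoc)

lemma left_act_one: "u \<in> KV \<Longrightarrow> left_act G \<one> u = u"
  using coset_carrier by (auto simp: VW_def lcos_mult_one)

section \<open>Translations and connectedness of the Cayley graph\<close>

lemma cayley_translate: "g \<in> carrier G \<Longrightarrow> cay x y \<Longrightarrow> cay (g \<otimes> x) (g \<otimes> y)"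
  unfolding cayley_adj_def using S_carrier by (metis Units_eq Units_l_cancel m_assoc m_closed subsetD)

lemma cayley_walk_translate:
  assumes "g \<in> carrier G"
  shows "(cay ^^ n) x y \<Longrightarrow> (cay ^^ n) (g \<otimes> x) (g \<otimes> y)"
proof (induction n arbitrary: y)
  case (Suc n)
  then obtain z where "(cay ^^ n) x z" "cay z y" by auto
  then show ?case using Suc.IH cayley_translate[OF assms] by (meson relpowp_Suc_I)
qed simp

lemma cayley_reach: "g \<in> carrier G \<Longrightarrow> \<exists>n. (cay ^^ n) \<one> g"
proof -
  assume "g \<in> carrier G"
  then have "g \<in> generate G S" using generates by simp
  then show ?thesis
  proof (induction rule: generate.induct)
    case one
    show ?case by (intro exI[of _ 0]) simp
  next
    case (incl h)
    \<comment> \<open>A generator may be trivial, and \<open>cayley_adj\<close> has no loops; the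
      walk of length 0 covers this case.\<close>
    then have "h = \<one> \<or> cay \<one> h" using S_carrier unfolding cayley_adj_def by (metis l_one one_closed subsetD)
    then have "(cay ^^ 0) \<one> h \<or> (cay ^^ 1) \<one> h" by auto
    then show ?case by blast
  next
    case (inv h)
    then have h: "h \<in> carrier G" using S_carrier by auto
    then have "inv h = \<one> \<or> cay \<one> (inv h)"
      using inv unfolding cayley_adj_def by (metis inv_closed l_inv one_closed)
    then have "(cay ^^ 0) \<one> (inv h) \<or> (cay ^^ 1) \<one> (inv h)" by auto
    then show ?case by blast
  next
    case (eng h1 h2)
    have h: "h1 \<in> carrier G" "h2 \<in> carrier G" using eng generates by auto
    obtain m n where "(cay ^^ m) \<one> h1" "(cay ^^ n) \<one> h2" using eng by blast
    \<comment> \<open>The walk to \<open>h1\<close> is continued by the \<open>h1\<close>-translate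
      of the walk to \<open>h2\<close>.\<close>
    then have "(cay ^^ (m + n)) \<one> (h1 \<otimes> h2)"
      using cayley_walk_translate[OF h(1), of n \<one> h2] h relpowp_trans[of m cay \<one> h1 n] by simp
    then show ?case by blast
  qed
qed

section \<open>Adjacency and translations in the coned-off graph\<close>

lemma coned_in: "K u v \<Longrightarrow> u \<in> KV \<and> v \<in> KV"
  by (simp add: coned_adj_def)

lemma coned_simps [simp]:
  "K (Inl x) (Inl y) \<longleftrightarrow> cay x y"
  "K (Inl x) (Inr w) \<longleftrightarrow> w \<in> cosets_W G P \<Lambda> \<and> x \<in> w"
  "K (Inr w) (Inl x) \<longleftrightarrow> w \<in> cosets_W G P \<Lambda> \<and> x \<in> w"
  "\<not> K (Inr w) (Inr w')"
  using coset_carrier by (auto simp: coned_adj_def VW_def cayley_adj_def)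

lemma coned_sym: "K u v \<Longrightarrow> K v u"
  by (cases u; cases v) (auto simp: cayley_adj_def)

lemma coned_translate:
  assumes g: "g \<in> carrier G" and uv: "K u v"
  shows "K (left_act G g u) (left_act G g v)"
proof -
  have w: "g <# w \<in> cosets_W G P \<Lambda>" if "w \<in> cosets_W G P \<Lambda>" for w
    using left_act_in[OF g, of "Inr w"] that by (auto simp: VW_def)
  have m: "x \<in> w \<Longrightarrow> g \<otimes> x \<in> g <# w" for x w by (auto simp: l_coset_def)
  show ?thesis using uv w m cayley_translate[OF g] by (cases u; cases v) auto
qed

lemma left_act_automorphism:
  assumes g: "g \<in> carrier G"
  shows "automorphism KV K (left_act G g)"
  unfolding automorphism_def
proof (intro conjI ballI)
  have inv1: "left_act G (inv g) (left_act G g u) = u" if "u \<in> KV" for u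
    using left_act_mult[of "inv g" g u] left_act_one that g by simp
  have inv2: "left_act G g (left_act G (inv g) u) = u" if "u \<in> KV" for u
    using left_act_mult[of g "inv g" u] left_act_one that g by simp
  show "bij_betw (left_act G g) KV KV"
    by (rule bij_betw_byWitness[where f' = "left_act G (inv g)"])
      (use inv1 inv2 left_act_in g in auto)
  fix x y assume "x \<in> KV" "y \<in> KV"
  then show "K (left_act G g x) (left_act G g y) \<longleftrightarrow> K x y"
    using coned_translate[OF g] coned_translate[of "inv g"] inv1 g by (metis inv_closed)
qed

lemma coned_connected_simple_graph:
  "connected_graph KV K \<Longrightarrow> connected_simple_graph KV K"
  by unfold_locales (use coned_in coned_sym in auto)

section \<open>Fineness and short detours around a coset\<close>

text \<open>Shorten the detour to a path without repeated vertices and close it through the cone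
  vertex: at most n + 1 vertices, plus \<open>Inr w\<close>.\<close>

lemma short_detour_circuit:
  assumes walk: "(avoiding K (Inr w) ^^ n) (Inl a) (Inl b)" and ab: "a \<noteq> b"
    and w: "w \<in> cosets_W G P \<Lambda>" "a \<in> w" "b \<in> w"
  obtains c where "circuit K c" "length c \<le> n + 2"
    "circuit_contains_edge c (Inr w) (Inl a)" "Inl b \<in> set c"
proof -
  obtain xs where xs: "distinct xs" "xs \<noteq> []" "hd xs = Inl a" "last xs = Inl b" "length xs \<le> Suc n"
    "\<And>i. Suc i < length xs \<Longrightarrow> avoiding K (Inr w) (xs ! i) (xs ! Suc i)"
    using relpowp_shortest_distinct[OF walk] by blast
  have ends: "xs ! 0 = Inl a" "xs ! (length xs - 1) = Inl b"
    using xs by (auto simp: hd_conv_nth last_conv_nth)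
  have len: "length xs \<ge> 2"
  proof (rule ccontr)
    assume "\<not> length xs \<ge> 2"
    then have "length xs = 1" using xs(2) by (metis One_nat_def Suc_1 le_SucE length_0_conv nat_le_linear le_0_eq)
    then show False using ends ab by simp
  qed
  \<comment> \<open>Every vertex but the last starts an edge that avoids \<open>Inr w\<close>, and
    the last is a group element.\<close>
  have notin: "Inr w \<notin> set xs"
  proof
    assume "Inr w \<in> set xs"
    then obtain i where i: "i < length xs" "xs ! i = Inr w" by (auto simp: in_set_conv_nth)
    show False
    proof (cases "Suc i < length xs")
      case True
      then show False using xs(6)[of i] i by (simp add: avoiding_def)
    next
      case False
      then have "i = length xs - 1" using i by simp
      then show False using ends i by simp
    qed
  qed
  let ?c = "Inr w # xs"
  have "K (?c ! i) (?c ! (Suc i mod length ?c))" if i: "i < length ?c" for i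
  proof (cases i)
    case 0
    then show ?thesis using ends w xs(2) by simp
  next
    case (Suc j)
    show ?thesis
    proof (cases "Suc j < length xs")
      case True
      then show ?thesis using Suc xs(6)[of j] by (simp add: avoiding_def)
    next
      case False
      then have "j = length xs - 1" "Suc i = length ?c" using i Suc by auto
      moreover from this have "?c ! i = Inl b" using Suc ends by (metis nth_Cons_Suc)
      ultimately show ?thesis using w by simp
    qed
  qed
  then have "circuit K ?c" using len xs notin by (simp add: circuit_def)
  moreover have "circuit_contains_edge ?c (Inr w) (Inl a)"
    unfolding circuit_contains_edge_def using ends xs(2) by (intro exI[of _ 0]) simp
  moreover have "Inl b \<in> set ?c" using xs last_in_set by fastforce
  ultimately show thesis using that[of ?c] xs by simp
qed

text \<open>Translating \<open>a\<close> to the identity turns the coset into one of finitely many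
  \<open>P l\<close>. By fineness only finitely many short circuits pass through the edge from
  \<open>P l\<close> to the identity, so \<open>inv a \<otimes> b\<close> ranges over a finite set
  and one \<open>B\<close> serves all cosets.\<close>

lemma fine_short_detours:
  assumes fine: "fine_graph K" and conn: "connected_graph KV K"
  obtains B where "\<And>w a b n. w \<in> cosets_W G P \<Lambda> \<Longrightarrow> a \<in> w \<Longrightarrow> b \<in> w \<Longrightarrow> n \<le> k \<Longrightarrow>
     (avoiding K (Inr w) ^^ n) (Inl a) (Inl b) \<Longrightarrow> \<exists>m\<le>B. (cay ^^ m) a b"
proof -
  interpret gr: connected_simple_graph KV K by (rule coned_connected_simple_graph[OF conn])
  define circuits where "circuits l n = {c. circuit K c \<and> length c = n \<and> circuit_contains_edge c (Inr (P l)) (Inl \<one>)}"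
    for l n
  \<comment> \<open>The group elements on these circuits; k + 2 is the length bound from
    \<open>short_detour_circuit\<close>.\<close>
  define T where "T = (\<Union>l\<in>\<Lambda>. \<Union>n\<le>k + 2. \<Union>c\<in>circuits l n. Inl -` set c)"
  have P1: "P l \<in> cosets_W G P \<Lambda>" "\<one> \<in> P l" if "l \<in> \<Lambda>" for l
  proof -
    have "\<one> <# P l \<in> cosets_W G P \<Lambda>" using that by (auto simp: cosets_W_def)
    then show "P l \<in> cosets_W G P \<Lambda>" using lcos_mult_one P_carrier that by simp
    show "\<one> \<in> P l" using subgroup_P that subgroup.one_closed by blast
  qed
  have "finite (circuits l n)" if "l \<in> \<Lambda>" for l n
    using fine P1[OF that] unfolding fine_graph_def circuits_def by simp
  then have fT: "finite T" unfolding T_def using finite_index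
    by (intro finite_UN_I finite_vimageI) auto
  define f where "f g = (SOME n. (cay ^^ n) \<one> g)" for g
  have f: "(cay ^^ f g) \<one> g" if "g \<in> carrier G" for g
    unfolding f_def using cayley_reach[OF that] by (rule someI_ex)
  show thesis
  \<comment> \<open>The sum dominates every \<open>f g\<close> with \<open>g\<close> in
    \<open>T\<close>, and needs no case distinction for empty \<open>T\<close>.\<close>
  proof (rule that[of "\<Sum>g\<in>T. f g"])
    fix w a b n
    assume w: "w \<in> cosets_W G P \<Lambda>" "a \<in> w" "b \<in> w" and n: "n \<le> k"
      and walk: "(avoiding K (Inr w) ^^ n) (Inl a) (Inl b)"
    have ab: "a \<in> carrier G" "b \<in> carrier G" using w coset_carrier by auto
    obtain l where l: "l \<in> \<Lambda>" "w = a <# P l" using coset_representative w by blast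
    define h where "h = inv a \<otimes> b"
    have h: "h \<in> carrier G" "a \<otimes> h = b" using ab by (auto simp: h_def m_assoc[symmetric])
    show "\<exists>m\<le>\<Sum>g\<in>T. f g. (cay ^^ m) a b"
    proof (cases "a = b")
      case True
      then show ?thesis by (intro exI[of _ 0]) simp
    next
      case False
      then have h1: "\<one> \<noteq> h" using h ab by auto
      have "inv a <# w = P l" using l ab P_carrier by (simp add: lcos_m_assoc lcos_mult_one)
      moreover have "(avoiding K (left_act G (inv a) (Inr w)) ^^ n)
          (left_act G (inv a) (Inl a)) (left_act G (inv a) (Inl b))"
        using walk w ab
        by (subst gr.automorphism_avoiding_iff[OF left_act_automorphism]) (auto simp: VW_def)
      ultimately have walk': "(avoiding K (Inr (P l)) ^^ n) (Inl \<one>) (Inl h)"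
        using ab by (simp add: h_def)
      have "h \<in> inv a <# w" using w by (auto simp: h_def l_coset_def)
      then have hP: "h \<in> P l" using \<open>inv a <# w = P l\<close> by simp
      obtain c where "circuit K c" "length c \<le> n + 2"
        "circuit_contains_edge c (Inr (P l)) (Inl \<one>)" "Inl h \<in> set c"
        using short_detour_circuit[OF walk' h1] P1 l hP by blast
      then have "h \<in> T" using l n unfolding T_def circuits_def by fastforce
      then have "f h \<le> (\<Sum>g\<in>T. f g)" using fT by (intro member_le_sum) auto
      moreover have "(cay ^^ f h) a b"
        using cayley_walk_translate[OF ab(1) f[OF h(1)]] ab h by simp
      ultimately show ?thesis by blast
    qed
  qed
qed

section \<open>From coned-off paths to word distance\<close>

text \<open>A Cayley edge costs 1, and a passage through a cone vertex costs at most
  \<open>B\<close> for two edges, so \<open>Suc B\<close> per edge suffices. The induction is strong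
  because such a passage goes back two positions; cone vertices are never adjacent, so a group
  element precedes each of them.\<close>

lemma cayley_walk_along_path:
  assumes path: "\<And>i. i < D \<Longrightarrow> K (p i) (p (Suc i))"
    and jump: "\<And>i a w b. Suc (Suc i) \<le> D \<Longrightarrow> p i = Inl a \<Longrightarrow> p (Suc i) = Inr w \<Longrightarrow>
        p (Suc (Suc i)) = Inl b \<Longrightarrow> \<exists>m\<le>B. (cay ^^ m) a b"
    and start: "p s = Inl a"
  shows "s \<le> i \<Longrightarrow> i \<le> D \<Longrightarrow> p i = Inl b \<Longrightarrow> \<exists>m\<le>(i - s) * Suc B. (cay ^^ m) a b"
proof (induction i arbitrary: b rule: less_induct)
  case (less i)
  show ?case
  proof (cases "i = s")
    case True
    then show ?thesis using less start by (intro exI[of _ 0]) simp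
  next
    case False
    then obtain j where j: "i = Suc j" "s \<le> j" using less by (cases i) auto
    have Kj: "K (p j) (Inl b)" using path[of j] j less by simp
    show ?thesis
    proof (cases "p j")
      case (Inl c)
      then obtain m where m: "m \<le> (j - s) * Suc B" "(cay ^^ m) a c"
        using less.IH[of j c] Inl j less.prems by (metis Suc_leD lessI)
      then have "(cay ^^ Suc m) a b" using Kj Inl by auto
      moreover have "Suc m \<le> (i - s) * Suc B" using m j by (simp add: Suc_diff_le)
      ultimately show ?thesis by blast
    next
      case (Inr w)
      then have "j \<noteq> s" using start by auto
      then obtain k where k: "j = Suc k" "s \<le> k" using j by (cases j) auto
      have Kk: "K (p k) (Inr w)" using path[of k] k j less Inr by simp
      then obtain c where c: "p k = Inl c" by (cases "p k") auto
      obtain m where m: "m \<le> (k - s) * Suc B" "(cay ^^ m) a c"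
        using less.IH[of k c] c k j less.prems by (metis Suc_leD lessI less_SucI)
      obtain m' where m': "m' \<le> B" "(cay ^^ m') c b"
        using jump[of k c w b] c k j Inr less by auto
      have "(cay ^^ (m + m')) a b" using relpowp_trans m m' by metis
      moreover have "m + m' \<le> (i - s) * Suc B" using m m' j k by (simp add: Suc_diff_le)
      ultimately show ?thesis by blast
    qed
  qed
qed

text \<open>If an endpoint is a coset, its neighbour on the path is an element of it. Dropping such
  endpoints leaves a path between group elements of \<open>as_set u\<close> and
  \<open>as_set u'\<close>.\<close>

lemma distS_le_of_path:
  assumes p: "p 0 = u" "p D = u'" "\<And>i. i < D \<Longrightarrow> K (p i) (p (Suc i))"
    and uu: "u \<in> KV" "u' \<in> KV" "u \<noteq> u'"
    and jump: "\<And>i a w b. Suc (Suc i) \<le> D \<Longrightarrow> p i = Inl a \<Longrightarrow> p (Suc i) = Inr w \<Longrightarrow>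
        p (Suc (Suc i)) = Inl b \<Longrightarrow> \<exists>m\<le>B. (cay ^^ m) a b"
  shows "distS G S u u' \<le> D * Suc B"
proof -
  have D: "D > 0" using p uu by (cases D) auto
  have "\<exists>s a. s \<le> 1 \<and> p s = Inl a \<and> a \<in> as_set u \<and> (s = 1 \<longrightarrow> (\<exists>w. u = Inr w))"
  proof (cases u)
    case (Inl a)
    then show ?thesis using p by (intro exI[of _ 0]) auto
  next
    case (Inr w)
    then have "K (Inr w) (p 1)" using p(1) p(3)[of 0] D by simp
    then show ?thesis using Inr by (cases "p 1") auto
  qed
  then obtain s a where s: "s \<le> 1" "p s = Inl a" "a \<in> as_set u" "s = 1 \<longrightarrow> (\<exists>w. u = Inr w)" by blast
  have "\<exists>e b. D - 1 \<le> e \<and> e \<le> D \<and> p e = Inl b \<and> b \<in> as_set u'"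
  proof (cases u')
    case (Inl b)
    then show ?thesis using p by (intro exI[of _ D]) auto
  next
    case (Inr w)
    then have "K (p (D - 1)) (Inr w)" using p(2) p(3)[of "D - 1"] D by simp
    then show ?thesis using Inr by (cases "p (D - 1)") auto
  qed
  then obtain e b where e: "D - 1 \<le> e" "e \<le> D" "p e = Inl b" "b \<in> as_set u'" by blast
  \<comment> \<open>Otherwise \<open>p 0\<close> would be both the coset \<open>u\<close> and a
    group element; the last conjunct on \<open>s\<close> was recorded for this.\<close>
  have "s \<le> e"
  proof (rule ccontr)
    assume "\<not> s \<le> e"
    then have "s = 1" "e = 0" using s e by auto
    then show False using s e p by auto
  qed
  then obtain m where m: "m \<le> (e - s) * Suc B" "(cay ^^ m) a b"
    using cayley_walk_along_path[of D p B s a e b] p(3) jump s(2) e by blast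
  then have "setdist cay (as_set u) (as_set u') \<le> m" using setdist_le s e by metis
  also have "m \<le> D * Suc B"
    using m(1) e by (meson diff_le_self le_trans mult_le_mono1)
  finally show ?thesis by (simp add: distS_def)
qed

end

section \<open>Invariant cliques for finite subgroups\<close>

theorem theorem2p5:
  fixes G :: "('a, 'b) monoid_scheme" and S :: "'a set"
    and P :: "'l \<Rightarrow> 'a set" and \<Lambda> :: "'l set"
  assumes "group G"
    and "finite S" and "S \<subseteq> carrier G" and "generate G S = carrier G"
    and "finite \<Lambda>" and "\<And>l. l \<in> \<Lambda> \<Longrightarrow> subgroup (P l) G"
    and "relatively_hyperbolic G S P \<Lambda>"
  shows "\<exists>N. \<forall>n\<ge>N. \<forall>F. subgroup F G \<and> finite F \<longrightarrow>
           (\<exists>C. C \<noteq> {} \<and> clique (VW G P \<Lambda>) (rips_adj G S P \<Lambda> n) C \<and>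
                (\<forall>f\<in>F. left_act G f ` C = C))"
proof -
  interpret group G by fact
  interpret peripheral_structure G S P \<Lambda> 
    by (intro peripheral_structure.intro peripheral_structure_axioms.intro) (fact assms)+
  obtain \<delta> where fine: "fine_graph K" and hyp: "hyperbolic_graph KV K \<delta>"
    using assms(7) unfolding relatively_hyperbolic_def by blast
  then have conn: "connected_graph KV K" by (simp add: hyperbolic_graph_def)
  interpret gr: connected_simple_graph KV K by (rule coned_connected_simple_graph[OF conn])
  obtain R :: nat where R: "4 * \<delta> + 1 \<le> real R" using real_arch_simple by blast
  \<comment> \<open>The detours will have length at most 10R: 8R to join \<open>u\<close> and
    \<open>u'\<close> off the coset, and 2R along the geodesic. Both \<open>R\<close> and
    \<open>B\<close> are fixed before \<open>F\<close>.\<close>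
  obtain B where B: "\<And>w a b n. w \<in> cosets_W G P \<Lambda> \<Longrightarrow> a \<in> w \<Longrightarrow> b \<in> w \<Longrightarrow> n \<le> 10 * R \<Longrightarrow>
     (avoiding K (Inr w) ^^ n) (Inl a) (Inl b) \<Longrightarrow> \<exists>m\<le>B. (cay ^^ m) a b"
    using fine_short_detours[OF fine conn] by blast
  have main: "\<exists>C. C \<noteq> {} \<and> clique KV (rips_adj G S P \<Lambda> n) C \<and> (\<forall>f\<in>F. left_act G f ` C = C)"
    if n: "2 * R * Suc B \<le> n" and F: "subgroup F G" "finite F" for n F
  proof -
    have FG: "F \<subseteq> carrier G" using F subgroup.subset by blast
    \<comment> \<open>The \<open>F\<close>-orbit of the identity vertex.\<close>
    let ?Y = "Inl ` F :: ('a + 'a set) set"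
    have Y: "finite ?Y" "?Y \<noteq> {}" "?Y \<subseteq> KV"
      using F FG subgroup.one_closed by (auto simp: VW_def)
    obtain C where C: "C \<noteq> {}" "C \<subseteq> KV"
      "\<And>u u'. u \<in> C \<Longrightarrow> u' \<in> C \<Longrightarrow> gr.d u u' \<le> 2 * R"
      "\<And>u u' w. u \<in> C \<Longrightarrow> u' \<in> C \<Longrightarrow> w \<in> KV \<Longrightarrow> w \<noteq> u \<Longrightarrow> w \<noteq> u' \<Longrightarrow> gr.d u w \<le> 2 * R \<Longrightarrow>
         \<exists>n\<le>8 * R. (avoiding K w ^^ n) u u'"
      "\<And>\<phi>. automorphism KV K \<phi> \<Longrightarrow> \<phi> ` ?Y = ?Y \<Longrightarrow> \<phi> ` C = C"
      using gr.hyperbolic_coarse_fixed_set[OF hyp R Y] by blast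
    have "left_act G f ` C = C" if f: "f \<in> F" for f
    proof (rule C(5))
      show "automorphism KV K (left_act G f)" using left_act_automorphism FG f by blast
      have "(\<lambda>x. f \<otimes>\<^bsub>G\<^esub> x) ` F = F"
      proof
        show "(\<lambda>x. f \<otimes>\<^bsub>G\<^esub> x) ` F \<subseteq> F" using F f subgroup.m_closed by fastforce
        show "F \<subseteq> (\<lambda>x. f \<otimes>\<^bsub>G\<^esub> x) ` F"
        proof
          fix x assume x: "x \<in> F"
          have "inv\<^bsub>G\<^esub> f \<otimes>\<^bsub>G\<^esub> x \<in> F"
            using F f x subgroup.m_closed subgroup.m_inv_closed by metis
          moreover have "x = f \<otimes>\<^bsub>G\<^esub> (inv\<^bsub>G\<^esub> f \<otimes>\<^bsub>G\<^esub> x)"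
            using FG f x by (auto simp: m_assoc[symmetric] subset_iff)
          ultimately show "x \<in> (\<lambda>x. f \<otimes>\<^bsub>G\<^esub> x) ` F" by blast
        qed
      qed
      then show "left_act G f ` ?Y = ?Y" by (metis (no_types, lifting) image_cong image_image left_act.simps(1))
    qed
    moreover have "rips_adj G S P \<Lambda> n u u'" if u: "u \<in> C" "u' \<in> C" "u \<noteq> u'" for u u'
    proof -
      have uV: "u \<in> KV" "u' \<in> KV" using u C by auto
      let ?D = "gr.d u u'"
      have D: "?D \<le> 2 * R" using C(3) u by blast
      obtain p where p: "p 0 = u" "p ?D = u'" "\<And>i. i < ?D \<Longrightarrow> K (p i) (p (Suc i))"
        "\<And>i. i \<le> ?D \<Longrightarrow> p i \<in> KV \<and> gr.d u (p i) = i \<and> gr.d (p i) u' = ?D - i"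
        using gr.geodesic[OF uV] by blast
      have "distS G S u u' \<le> ?D * Suc B"
      proof (rule distS_le_of_path[OF p(1-3) uV u(3)])
        fix i a w b
        assume i: "Suc (Suc i) \<le> ?D" and pi: "p i = Inl a" "p (Suc i) = Inr w" "p (Suc (Suc i)) = Inl b"
        have dj: "gr.d u (p j) = j" if "j \<le> ?D" for j using p(4) that by blast
        \<comment> \<open>Distances from \<open>u\<close> are distinct along a geodesic, so it meets
          the coset only once.\<close>
        have ne: "p j \<noteq> Inr w" if "j \<le> ?D" "j \<noteq> Suc i" for j
          using dj[of j] dj[of "Suc i"] that i pi by force
        have w: "w \<in> cosets_W G P \<Lambda>" "a \<in> w" "b \<in> w"
          using p(3)[of i] p(3)[of "Suc i"] i pi by auto
        have "Inr w \<in> KV" "gr.d u (Inr w) \<le> 2 * R" "Inr w \<noteq> u" "Inr w \<noteq> u'"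
          using p(4)[of "Suc i"] pi i D ne[of 0] ne[of ?D] p(1,2) by auto
        then obtain m where m: "m \<le> 8 * R" "(avoiding K (Inr w) ^^ m) u u'"
          using C(4) u by blast
        \<comment> \<open>The detour from \<open>a\<close> to \<open>b\<close> runs back along the
          geodesic to \<open>u\<close>, then off \<open>w\<close> to \<open>u'\<close>, then back
          along the geodesic to \<open>b\<close>.\<close>
        have "(avoiding K (Inr w) ^^ (i - 0)) (p 0) (p i)"
          by (rule relpowp_segment) (use p(3) ne i in \<open>auto simp: avoiding_def\<close>)
        then have 1: "(avoiding K (Inr w) ^^ i) (Inl a) u"
          using gr.avoiding_sym p pi by simp
        have "(avoiding K (Inr w) ^^ (?D - Suc (Suc i))) (p (Suc (Suc i))) (p ?D)"
          by (rule relpowp_segment) (use p(3) ne i in \<open>auto simp: avoiding_def\<close>)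
        then have 2: "(avoiding K (Inr w) ^^ (?D - Suc (Suc i))) u' (Inl b)"
          using gr.avoiding_sym p pi by simp
        have "(avoiding K (Inr w) ^^ (i + m + (?D - Suc (Suc i)))) (Inl a) (Inl b)"
          using relpowp_trans[OF relpowp_trans[OF 1 m(2)] 2] .
        moreover have "i + m + (?D - Suc (Suc i)) \<le> 10 * R" using m D i by linarith
        ultimately show "\<exists>m\<le>B. (cay ^^ m) a b" using B w by blast
      qed
      also have "\<dots> \<le> 2 * R * Suc B" using D by (rule mult_le_mono1)
      finally show ?thesis using n uV u by (simp add: rips_adj_def)
    qed
    ultimately show ?thesis using C by (intro exI[of _ C]) (auto simp: clique_def)
  qed
  show ?thesis by (intro exI[of _ "2 * R * Suc B"]) (use main in blast)
qed

end
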